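(* Let $A$ and $A'$ be $d$-dimensional quantum systems and let $\mathrm{id}$ be the identity channel from $A$ to $A'$. Then $$\gamma_{\mathrm{EBC}^\star(A\to A')}(\mathrm{id})=2d-1 .$$
   Context: $\mathrm{HP}(A\to A')$ is the real vector space of Hermitian-preserving linear maps from operators on $\mathcal H_A$ to operators on $\mathcal H_{A'}$. Quasiprobability extent: for $S\subset \mathrm{HP}(A\to A')$ and $\mathcal{E}\in\mathrm{HP}(A\to A')$, $\gamma_S(\mathcal{E})=\inf\{\sum_{i=1}^m|a_i| : m\ge 1,\ \mathcal{E}=\sum_{i=1}^m a_i\mathcal{F}_i,\ \mathcal{F}_i\in S,\ a_i\in\mathbb{R}\}$ ($=\infty$ if no decomposition exists). $\mathrm{EBC}^\star(A\to A')$ (entanglement-breaking measure-and-prepare maps with weighting by classical side information) is the set of all maps $\rho\mapsto\sum_i\beta_i\,\mathrm{tr}[M_i\rho]\,\sigma_i$ where $\beta_i\in[-1,1]$, $(M_i)_i$ is a (countable) POVM on $A$ (i.e. $M_i\ge0$, $\sum_iM_i=\mathbb{1}$), and the $\sigma_i$ are density operators on $A'$. *)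

theory Defs
  imports "HOL-Analysis.Analysis" "HOL-Library.Nonpos_Ints"
begin

text \<open>
  A system of dimension \<open>CARD('a)\<close> has Hilbert space \<open>complex ^ 'a\<close>; its operators are the
  matrices \<open>complex ^ 'a ^ 'a\<close>. The libraries provide only real scaling on this type, hence
  the following complex one.
\<close>

definition cscale :: "complex \<Rightarrow> complex ^ 'a ^ 'a \<Rightarrow> complex ^ 'a ^ 'a" where
  "cscale c X = (\<chi> i j. c * X $ i $ j)"

definition hermitian :: "complex ^ 'a ^ 'a \<Rightarrow> bool" where
  "hermitian X \<longleftrightarrow> (\<forall>i j. X $ i $ j = cnj (X $ j $ i))"

definition psd :: "complex ^ 'a ^ 'a \<Rightarrow> bool" where
  "psd M \<longleftrightarrow> (\<forall>v. (\<Sum>i\<in>UNIV. cnj (v $ i) * (M *v v) $ i) \<in> \<real>\<^sub>\<ge>\<^sub>0)"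

definition density_op :: "complex ^ 'a ^ 'a \<Rightarrow> bool" where
  "density_op \<sigma> \<longleftrightarrow> psd \<sigma> \<and> trace \<sigma> = 1"

definition HP :: "(complex ^ 'a ^ 'a \<Rightarrow> complex ^ 'b ^ 'b) set" where
  "HP = {F. Vector_Spaces.linear cscale cscale F \<and> (\<forall>X. hermitian X \<longrightarrow> hermitian (F X))}"

text \<open>
  The outcome set \<open>I\<close> ranges over all sets of naturals, so that finite and countably infinite
  POVMs are both covered.
\<close>

definition povm :: "nat set \<Rightarrow> (nat \<Rightarrow> complex ^ 'a ^ 'a) \<Rightarrow> bool" where
  "povm I M \<longleftrightarrow> (\<forall>i\<in>I. psd (M i)) \<and> (M has_sum mat 1) I"

definition EBC_star :: "(complex ^ 'a ^ 'a \<Rightarrow> complex ^ 'b ^ 'b) set" where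
  "EBC_star = {F. \<exists>I \<beta> M \<sigma>. povm I M \<and>
     (\<forall>i\<in>I. \<beta> i \<in> {-1..1::real} \<and> density_op (\<sigma> i)) \<and>
     (\<forall>\<rho>. ((\<lambda>i. cscale (of_real (\<beta> i) * trace (M i ** \<rho>)) (\<sigma> i)) has_sum F \<rho>) I)}"

text \<open>
  The infimum is taken in \<^typ>\<open>ereal\<close>, so it is \<open>\<infinity>\<close> if there is no decomposition.
  The definition is meant for \<open>S \<subseteq> HP\<close> and \<open>E \<in> HP\<close>; see \<open>EBC_star_subset_HP\<close> and
  \<open>id_in_HP\<close> below.
\<close>

definition quasiprob_extent ::
  "(complex ^ 'a ^ 'a \<Rightarrow> complex ^ 'b ^ 'b) set \<Rightarrow> (complex ^ 'a ^ 'a \<Rightarrow> complex ^ 'b ^ 'b) \<Rightarrow> ereal"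
where
  "quasiprob_extent S E = Inf {ereal (\<Sum>i<m. \<bar>a i\<bar>) | m (a :: nat \<Rightarrow> real) F.
     m \<ge> 1 \<and> (\<forall>i<m. F i \<in> S) \<and> E = (\<lambda>X. \<Sum>i<m. a i *\<^sub>R F i X)}"

lemma vector_space_cscale: "vector_space (cscale :: complex \<Rightarrow> complex ^ 'a ^ 'a \<Rightarrow> _)"
  by unfold_locales (auto simp: cscale_def vec_eq_iff algebra_simps)

lemma psd_imp_hermitian:
  fixes M :: "complex ^ 'a ^ 'a"
  assumes "psd M"
  shows "hermitian M"
proof -
  define Q where "Q v = (\<Sum>k\<in>UNIV. cnj (v $ k) * (M *v v) $ k)" for v
  have Q: "Im (Q v) = 0" for v
    using assms unfolding psd_def Q_def by (metis complex_nonneg_Reals_iff)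
  have expand: "Q (axis i 1 + c *s axis j 1) =
      M $ i $ i + c * M $ i $ j + cnj c * M $ j $ i + cnj c * c * M $ j $ j" for i j c
  proof -
    have ax: "(M *v axis l 1) $ k = M $ k $ l" for k l
    proof -
      have "(M *v axis l 1) $ k = (\<Sum>j\<in>UNIV. if j = l then M $ k $ j else 0)"
        unfolding matrix_vector_mult_def vec_lambda_beta by (intro sum.cong) (auto simp: axis_def)
      then show ?thesis by simp
    qed
    have mv: "(M *v (axis i 1 + c *s axis j 1)) $ k = M $ k $ i + c * M $ k $ j" for k
      by (simp add: matrix_vector_right_distrib vector_scalar_commute ax)
    have "Q (axis i 1 + c *s axis j 1)
        = (\<Sum>k\<in>UNIV. (if k = i then M $ k $ i + c * M $ k $ j else 0)
                    + (if k = j then cnj c * (M $ k $ i + c * M $ k $ j) else 0))"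
      unfolding Q_def mv by (intro sum.cong) (auto simp: axis_def algebra_simps)
    then show ?thesis
      by (simp add: sum.distrib algebra_simps)
  qed
  have diag: "Im (M $ i $ i) = 0" for i
    using Q[of "axis i 1 + 0 *s axis i 1"] unfolding expand by simp
  show ?thesis
    unfolding hermitian_def
  proof (intro allI)
    fix i j
    have "Im (M $ i $ j) + Im (M $ j $ i) = 0"
      using Q[of "axis i 1 + 1 *s axis j 1"] diag unfolding expand by simp
    moreover have "Re (M $ i $ j) = Re (M $ j $ i)"
      using Q[of "axis i 1 + \<i> *s axis j 1"] diag unfolding expand by simp
    ultimately show "M $ i $ j = cnj (M $ j $ i)"
      by (simp add: complex_eq_iff)
  qed
qed

lemma trace_mult_hermitian_real:
  assumes "hermitian M" "hermitian X"
  shows "cnj (trace (M ** X)) = trace (M ** X)"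
proof -
  have 1: "cnj (M $ i $ k) = M $ k $ i" "cnj (X $ i $ k) = X $ k $ i" for i k
    using assms unfolding hermitian_def by metis+
  have "cnj (trace (M ** X)) = trace (X ** M)"
    by (simp add: trace_def matrix_matrix_mult_def 1 mult.commute)
  also have "\<dots> = trace (M ** X)"
    by (rule trace_mul_sym)
  finally show ?thesis .
qed

lemma id_in_HP: "id \<in> HP"
  by (simp add: HP_def vector_space.linear_id[OF vector_space_cscale])

lemma EBC_star_subset_HP:
  "(EBC_star :: (complex ^ 'a ^ 'a \<Rightarrow> complex ^ 'b ^ 'b) set) \<subseteq> HP"
proof
  fix F :: "complex ^ 'a ^ 'a \<Rightarrow> complex ^ 'b ^ 'b"
  assume "F \<in> EBC_star"
  then obtain I \<beta> M \<sigma> where M: "povm I M"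
    and \<sigma>: "\<forall>i\<in>I. \<beta> i \<in> {-1..1::real} \<and> density_op (\<sigma> i)"
    and F: "\<And>\<rho>. ((\<lambda>i. cscale (of_real (\<beta> i) * trace (M i ** \<rho>)) (\<sigma> i)) has_sum F \<rho>) I"
    unfolding EBC_star_def by blast
  have add: "F (X + Y) = F X + F Y" for X Y
    by (rule has_sum_unique[OF F])
      (use has_sum_add[OF F[of X] F[of Y]] in
        \<open>simp add: matrix_add_ldistrib trace_add distrib_left
           vector_space.vector_space_assms(2)[OF vector_space_cscale]\<close>)
  have blin: "bounded_linear (cscale c :: complex ^ 'b ^ 'b \<Rightarrow> _)" for c
    by (intro linear_conv_bounded_linear[THEN iffD1] linearI)
      (simp_all add: cscale_def vec_eq_iff distrib_left)
  have tr: "trace (N ** cscale c X) = c * trace (N ** X)" for c and N X :: "complex ^ 'a ^ 'a"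
    by (simp add: trace_def matrix_matrix_mult_def cscale_def sum_distrib_left algebra_simps)
  have scale: "F (cscale c X) = cscale c (F X)" for c X
    by (rule has_sum_unique[OF F])
      (use has_sum_bounded_linear[OF blin[of c] F[of X]] in
        \<open>simp add: o_def tr vector_space.vector_space_assms(3)[OF vector_space_cscale] algebra_simps\<close>)
  have herm: "hermitian (F X)" if X: "hermitian X" for X
    unfolding hermitian_def
  proof (intro allI)
    fix k l
    define G where "G Z = Z $ k $ l - cnj (Z $ l $ k)" for Z :: "complex ^ 'b ^ 'b"
    have "bounded_linear G"
      by (intro linear_conv_bounded_linear[THEN iffD1] linearI)
        (simp_all add: G_def scaleR_diff_right)
    from has_sum_bounded_linear[OF this F[of X]]
    have "((\<lambda>i. G (cscale (of_real (\<beta> i) * trace (M i ** X)) (\<sigma> i))) has_sum G (F X)) I"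
      by (simp add: o_def)
    moreover have "G (cscale (of_real (\<beta> i) * trace (M i ** X)) (\<sigma> i)) = 0" if "i \<in> I" for i
    proof -
      have "hermitian (M i)" "hermitian (\<sigma> i)"
        using M \<sigma> that by (auto simp: povm_def density_op_def intro: psd_imp_hermitian)
      then have "cnj (trace (M i ** X)) = trace (M i ** X)" "cnj (\<sigma> i $ l $ k) = \<sigma> i $ k $ l"
        using trace_mult_hermitian_real[OF _ X] unfolding hermitian_def by metis+
      then show ?thesis
        by (simp add: G_def cscale_def)
    qed
    ultimately have "((\<lambda>_. 0) has_sum G (F X)) I"
      by (metis (mono_tags, lifting) has_sum_cong)
    then have "G (F X) = 0"
      using has_sum_0[of I "\<lambda>_. 0 :: complex"] has_sum_unique by blast
    then show "F X $ k $ l = cnj (F X $ l $ k)"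
      by (simp add: G_def)
  qed
  have "Vector_Spaces.linear cscale cscale F"
    by (simp add: Vector_Spaces.linear_iff vector_space_cscale add scale)
  then show "F \<in> HP"
    using herm by (simp add: HP_def)
qed

end

theory Submission imports Defs begin

text \<open>
  Lower bound: the linear functional \<open>W F = 2 \<Sum>\<^sub>i\<^sub>j \<langle>i|F(|i\<rangle>\<langle>j|)|j\<rangle> - tr F(1)\<close> takes the value
  \<open>d (2 d - 1)\<close> at the identity. On a measure-and-prepare term \<open>\<beta> tr[M \<rho>] \<sigma>\<close> it equals
  \<open>\<beta> (2 tr[M \<sigma>] - tr M)\<close>, which is at most \<open>tr M\<close> in absolute value because
  \<open>0 \<le> tr[M \<sigma>] \<le> tr M\<close>; hence \<open>|W F| \<le> d\<close> for every \<open>F\<close> in \<open>EBC_star\<close>.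

  Upper bound: \<open>id = d T - (d - 1) R\<close>. Here \<open>T\<close> measures and prepares the vectors
  \<open>d\<^sup>-\<^sup>1\<^sup>/\<^sup>2 (\<omega>\<^sub>1, ..., \<omega>\<^sub>d)\<close> with independent uniform phases \<open>\<omega>\<^sub>i\<close> in \<open>{1, \<i>, -1, -\<i>}\<close>, so that
  \<open>d T(\<rho>)\<close> keeps the off-diagonal of \<open>\<rho>\<close> and has diagonal entries \<open>tr \<rho>\<close>. The map \<open>R\<close> measures
  the standard basis and on outcome \<open>k\<close> prepares the maximally mixed state orthogonal to
  \<open>|k\<rangle>\<close>, so that \<open>(d - 1) R(\<rho>)\<close> is the remaining diagonal part of
  \<open>d T(\<rho>) - \<rho>\<close>.
\<close>

section \<open>Quadratic forms and positive semidefinite matrices\<close>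

definition outer :: "complex ^ 'a \<Rightarrow> complex ^ 'a ^ 'a" where
  "outer w = (\<chi> i j. w $ i * cnj (w $ j))"

definition qform :: "complex ^ 'a ^ 'a \<Rightarrow> complex ^ 'a \<Rightarrow> complex" where
  "qform M v = (\<Sum>i\<in>UNIV. cnj (v $ i) * (M *v v) $ i)"

lemma psd_iff_qform: "psd M \<longleftrightarrow> (\<forall>v. 0 \<le> Re (qform M v) \<and> Im (qform M v) = 0)"
  by (simp add: psd_def qform_def complex_nonneg_Reals_iff)

lemma qform_outer: "qform (outer w) v = of_real ((norm (\<Sum>i\<in>UNIV. cnj (w $ i) * v $ i))\<^sup>2)"
proof -
  let ?s = "\<Sum>i\<in>UNIV. cnj (w $ i) * v $ i"
  have "(outer w *v v) $ i = w $ i * ?s" for i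
    by (simp add: outer_def matrix_vector_mult_def sum_distrib_left mult.assoc)
  then have "qform (outer w) v = (\<Sum>i\<in>UNIV. cnj (cnj (w $ i) * v $ i) * ?s)"
    unfolding qform_def by (intro sum.cong) (simp_all add: mult_ac)
  also have "\<dots> = cnj ?s * ?s"
    by (simp only: sum_distrib_right cnj_sum)
  finally have "qform (outer w) v = cnj ?s * ?s" .
  then show ?thesis
    by (metis complex_norm_square mult.commute)
qed

lemma qform_diff: "qform (M - N) v = qform M v - qform N v"
  by (simp add: qform_def matrix_vector_mult_diff_rdistrib right_diff_distrib sum_subtractf)

lemma qform_scaleR: "qform (r *\<^sub>R M) v = of_real r * qform M v"
proof -
  have "((r *\<^sub>R M) *v v) $ i = of_real r * (M *v v) $ i" for i
    unfolding matrix_vector_mult_def vec_lambda_beta sum_distrib_left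
    by (intro sum.cong) (simp_all add: scaleR_conv_of_real[where 'a = complex])
  then show ?thesis
    by (simp add: qform_def sum_distrib_left mult_ac)
qed

lemma psd_outer: "psd (outer w)"
  by (simp add: psd_iff_qform qform_outer)

lemma psd_scaleR: "psd M \<Longrightarrow> 0 \<le> r \<Longrightarrow> psd (r *\<^sub>R M)"
  by (simp add: psd_iff_qform qform_scaleR)

lemma sum_cnj_axis: "(\<Sum>k\<in>UNIV. cnj (axis i 1 $ k) * f k) = (f i :: complex)"
proof -
  have "(\<Sum>k\<in>UNIV. cnj (axis i 1 $ k) * f k) = (\<Sum>k\<in>UNIV. if k = i then f k else 0)"
    by (intro sum.cong) (auto simp: axis_def)
  then show ?thesis by simp
qed

lemma matrix_vector_axis: "((M :: complex ^ 'a ^ 'b) *v axis i 1) $ k = M $ k $ i"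
proof -
  have "(M *v axis i 1) $ k = (\<Sum>j\<in>UNIV. if j = i then M $ k $ j else 0)"
    unfolding matrix_vector_mult_def vec_lambda_beta by (intro sum.cong) (auto simp: axis_def)
  then show ?thesis by simp
qed

lemma qform_axis: "qform M (axis i 1) = M $ i $ i"
  by (simp add: qform_def sum_cnj_axis matrix_vector_axis)

lemma psd_diag: "psd M \<Longrightarrow> 0 \<le> Re (M $ i $ i) \<and> Im (M $ i $ i) = 0"
  by (metis psd_iff_qform qform_axis)

text \<open>The identity behind completing the square: if \<open>M $ i $ i\<close> is positive,
  \<open>t = (M *v v) $ i / M $ i $ i\<close> minimises the right-hand side over
  \<open>t\<close>.\<close>

lemma qform_shift:
  assumes "hermitian M"
  shows "qform M (v - t *s axis i 1) =
    qform M v - cnj t * (M *v v) $ i - t * cnj ((M *v v) $ i) + cnj t * t * M $ i $ i"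
proof -
  have h: "cnj (M $ i $ k) = M $ k $ i" for k
    using assms unfolding hermitian_def by metis
  have mv: "(M *v (v - t *s axis i 1)) $ k = (M *v v) $ k - t * M $ k $ i" for k
    by (simp add: matrix_vector_mult_diff_distrib vector_scalar_commute matrix_vector_axis)
  have c: "cnj ((M *v v) $ i) = (\<Sum>k\<in>UNIV. cnj (v $ k) * M $ k $ i)"
    by (simp add: matrix_vector_mult_def h mult.commute)
  have "qform M (v - t *s axis i 1) = (\<Sum>k\<in>UNIV. cnj (v $ k) * (M *v v) $ k
      - t * (cnj (v $ k) * M $ k $ i) - cnj t * (cnj (axis i 1 $ k) * (M *v v) $ k)
      + cnj t * t * (cnj (axis i 1 $ k) * M $ k $ i))"
    unfolding qform_def mv by (intro sum.cong) (simp_all add: algebra_simps)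
  then show ?thesis
    by (simp add: c sum.distrib sum_subtractf sum_distrib_left[symmetric] sum_cnj_axis qform_def)
qed

text \<open>On the span of two basis vectors only the off-diagonal terms remain, and choosing the
  relative coefficient \<open>M $ i $ j\<close> makes the form equal to -2 |M_ij|^2, which
  positivity forces to vanish.\<close>

lemma psd_zero_diag:
  assumes "psd M" "\<And>i. M $ i $ i = 0"
  shows "M = 0"
proof -
  have "M $ i $ j = 0" for i j
  proof -
    have "qform M (axis j 1 - M $ i $ j *s axis i 1) = - of_real (2 * (norm (M $ i $ j))\<^sup>2)"
      by (simp add: qform_shift[OF psd_imp_hermitian[OF assms(1)]] qform_axis matrix_vector_axis
          assms(2) complex_norm_square mult.commute del: of_real_power)
    then show ?thesis
      using assms(1) by (metis (no_types, lifting) psd_iff_qform Re_complex_of_real uminus_complex.sel(1)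
          neg_0_le_iff_le norm_eq_zero zero_eq_power2 mult_le_0_iff zero_less_numeral not_less
          zero_le_power2 order.antisym)
  qed
  then show ?thesis by (simp add: vec_eq_iff)
qed

text \<open>Cholesky elimination, by induction on the number of nonzero diagonal entries.\<close>

lemma psd_decomp:
  fixes M :: "complex ^ 'a ^ 'a"
  assumes "psd M"
  shows "\<exists>n (w :: nat \<Rightarrow> _). M = (\<Sum>k<n. outer (w k))"
  using assms
proof (induction "card {i. M $ i $ i \<noteq> 0}" arbitrary: M rule: less_induct)
  case less
  show ?case
  proof (cases "\<forall>i. M $ i $ i = 0")
    case True
    then have "M = (\<Sum>k<0::nat. outer (undefined k))"
      using psd_zero_diag[OF less.prems] by simp
    then show ?thesis by blast
  next
    case False
    then obtain i where i: "M $ i $ i \<noteq> 0" by blast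
    define r where "r = Re (M $ i $ i)"
    have Mr: "M $ i $ i = of_real r" and r: "r > 0"
      using psd_diag[OF less.prems, of i] i by (auto simp: r_def complex_eq_iff)
    \<comment> \<open>Column \<open>i\<close>, scaled so that \<open>outer w\<close> agrees with
      \<open>M\<close> on all of row and column \<open>i\<close>; subtracting it leaves the Schur
      complement.\<close>
    define w where "w = (\<chi> j. M $ j $ i / of_real (sqrt r))"
    have herm: "cnj (M $ j $ k) = M $ k $ j" for j k
      using psd_imp_hermitian[OF less.prems] unfolding hermitian_def by metis
    have ss: "complex_of_real (sqrt r) * of_real (sqrt r) = of_real r"
      using r by (simp flip: of_real_mult)
    have out: "outer w $ j $ k = M $ j $ i * M $ i $ k / of_real r" for j k
      by (simp add: outer_def w_def herm ss)
    define N where "N = M - outer w"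
    \<comment> \<open>Completing the square: the form of \<open>N\<close> at \<open>v\<close> is the
      form of \<open>M\<close> at the minimising shift of \<open>v\<close> along axis
      \<open>i\<close>, so \<open>N\<close> inherits positivity.\<close>
    have "qform N v = qform M (v - ((M *v v) $ i / of_real r) *s axis i 1)" for v
    proof -
      let ?m = "(M *v v) $ i"
      have "(\<Sum>k\<in>UNIV. cnj (w $ k) * v $ k) = ?m / of_real (sqrt r)"
        by (simp add: w_def herm matrix_vector_mult_def sum_divide_distrib)
      then have "qform (outer w) v = of_real ((norm ?m)\<^sup>2 / r)"
        using r by (simp add: qform_outer norm_divide power_divide)
      also have "\<dots> = ?m * cnj ?m / of_real r"
        by (simp only: of_real_divide complex_norm_square)
      finally show ?thesis
        using r by (simp add: N_def qform_diff qform_shift[OF psd_imp_hermitian[OF less.prems]] Mr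
            field_simps)
    qed
    then have N: "psd N"
      using less.prems by (simp add: psd_iff_qform)
    have Ni: "N $ i $ i = 0"
      using r by (simp add: N_def out Mr)
    \<comment> \<open>Elimination creates no new nonzero diagonal entry: the new entry would be
      nonpositive, whereas \<open>N\<close> is positive semidefinite.\<close>
    have Nj: "N $ j $ j = 0" if "M $ j $ j = 0" for j
    proof -
      have "N $ j $ j = - of_real ((norm (M $ j $ i))\<^sup>2 / r)"
        using that complex_norm_square[of "M $ j $ i"] by (simp add: N_def out herm)
      then show ?thesis
        using psd_diag[OF N, of j] r by (auto simp: divide_le_0_iff)
    qed
    have "{j. N $ j $ j \<noteq> 0} \<subset> {j. M $ j $ j \<noteq> 0}"
      using Ni Nj i by blast
    then have "card {j. N $ j $ j \<noteq> 0} < card {j. M $ j $ j \<noteq> 0}"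
      by (intro psubset_card_mono) auto
    from less.hyps[OF this N] obtain n and u :: "nat \<Rightarrow> complex ^ 'a"
      where "N = (\<Sum>k<n. outer (u k))" by blast
    then have "M = (\<Sum>k<Suc n. outer ((u(n := w)) k))"
      by (simp add: N_def algebra_simps)
    then show ?thesis by blast
  qed
qed

section \<open>Bounds on the trace of a product of positive matrices\<close>

lemma trace_outer: "trace (outer w) = of_real ((norm w)\<^sup>2)"
proof -
  have "(norm w)\<^sup>2 = (\<Sum>i\<in>UNIV. (norm (w $ i))\<^sup>2)"
    by (simp add: norm_vec_def L2_set_def sum_nonneg)
  then show ?thesis
    by (simp add: trace_def outer_def complex_norm_square del: of_real_power)
qed

lemma trace_outer_mult_outer:
  "trace (outer w ** outer u) = of_real ((norm (\<Sum>i\<in>UNIV. cnj (w $ i) * u $ i))\<^sup>2)"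
proof -
  have "trace (outer w ** outer u) = (\<Sum>i\<in>UNIV. \<Sum>k\<in>UNIV. (cnj (w $ k) * u $ k) * (w $ i * cnj (u $ i)))"
    by (simp add: trace_def matrix_matrix_mult_def outer_def algebra_simps)
  also have "\<dots> = (\<Sum>k\<in>UNIV. cnj (w $ k) * u $ k) * cnj (\<Sum>k\<in>UNIV. cnj (w $ k) * u $ k)"
    by (subst sum.swap) (simp add: sum_product)
  finally show ?thesis
    by (simp only: complex_norm_square)
qed

lemma norm_sum_cnj_le: "norm (\<Sum>i\<in>UNIV. cnj (w $ i) * u $ i) \<le> norm w * norm (u :: complex ^ 'a)"
proof -
  have "norm (\<Sum>i\<in>UNIV. cnj (w $ i) * u $ i) \<le> (\<Sum>i\<in>UNIV. \<bar>norm (w $ i)\<bar> * \<bar>norm (u $ i)\<bar>)"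
    by (rule order.trans[OF norm_sum]) (simp add: norm_mult)
  also have "\<dots> \<le> norm w * norm u"
    unfolding norm_vec_def by (rule L2_set_mult_ineq)
  finally show ?thesis .
qed

lemma trace_sum: "trace (\<Sum>k\<in>K. f k) = (\<Sum>k\<in>K. trace (f k))"
  unfolding trace_def by (simp add: sum.swap[of _ K])

lemma matrix_mul_sum_left: "(\<Sum>k\<in>K. f k) ** (X :: complex ^ 'a ^ 'b) = (\<Sum>k\<in>K. f k ** X)"
  by (induction K rule: infinite_finite_induct)
    (auto simp: vec_eq_iff matrix_matrix_mult_def sum.distrib distrib_right)

lemma matrix_mul_sum_right: "(X :: complex ^ 'a ^ 'b) ** (\<Sum>k\<in>K. f k) = (\<Sum>k\<in>K. X ** f k)"
  by (induction K rule: infinite_finite_induct) (auto simp: matrix_add_ldistrib)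

text \<open>With both matrices split into rank-one terms, the trace of the product is a sum of
  squared inner products; Cauchy-Schwarz bounds each one by the corresponding product of
  traces.\<close>

lemma trace_mult_psd:
  assumes "psd M" "psd N"
  shows "0 \<le> Re (trace (M ** N))" "Re (trace (M ** N)) \<le> Re (trace M) * Re (trace N)"
proof -
  obtain n w where M: "M = (\<Sum>k<n::nat. outer (w k))" using psd_decomp[OF assms(1)] by blast
  obtain m u where N: "N = (\<Sum>l<m::nat. outer (u l))" using psd_decomp[OF assms(2)] by blast
  let ?s = "\<lambda>k l. norm (\<Sum>i\<in>UNIV. cnj (w k $ i) * u l $ i)"
  have MN: "Re (trace (M ** N)) = (\<Sum>k<n. \<Sum>l<m. (?s k l)\<^sup>2)"
    by (simp add: M N matrix_mul_sum_left matrix_mul_sum_right trace_sum trace_outer_mult_outer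
        sum.swap[of _ "{..<m}" "{..<n}"] del: of_real_power)
  then show "0 \<le> Re (trace (M ** N))"
    by (simp add: sum_nonneg)
  have "Re (trace M) * Re (trace N) = (\<Sum>k<n. \<Sum>l<m. (norm (w k))\<^sup>2 * (norm (u l))\<^sup>2)"
    by (simp add: M N trace_sum trace_outer sum_product del: of_real_power)
  moreover have "(?s k l)\<^sup>2 \<le> (norm (w k))\<^sup>2 * (norm (u l))\<^sup>2" for k l
    using power_mono[OF norm_sum_cnj_le[of "w k" "u l"], of 2] by (simp add: power_mult_distrib)
  ultimately show "Re (trace (M ** N)) \<le> Re (trace M) * Re (trace N)"
    by (simp add: MN sum_mono)
qed

section \<open>The witness functional and the lower bound\<close>

definition matrix_unit :: "'a \<Rightarrow> 'a \<Rightarrow> complex ^ 'a ^ 'a" where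
  "matrix_unit i j = (\<chi> k l. if k = i \<and> l = j then 1 else 0)"

text \<open>In terms of the Choi operator J of \<open>F\<close> and the unnormalised maximally
  entangled vector v, the sum of |i>|i>, this is the real part of 2 <v|J|v> - tr J. Taking real
  parts makes it a real-linear functional on all maps.\<close>

definition witness :: "(complex ^ 'a ^ 'a \<Rightarrow> complex ^ 'a ^ 'a) \<Rightarrow> real" where
  "witness F = 2 * (\<Sum>i\<in>UNIV. \<Sum>j\<in>UNIV. Re (F (matrix_unit i j) $ i $ j))
     - (\<Sum>i\<in>UNIV. Re (F (mat 1) $ i $ i))"

lemma trace_mult_matrix_unit: "trace (M ** matrix_unit i j) = M $ j $ i"
proof -
  have "trace (M ** matrix_unit i j)
      = (\<Sum>k\<in>UNIV. \<Sum>l\<in>UNIV. if l = i then if k = j then M $ k $ l else 0 else 0)"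
    unfolding trace_def matrix_matrix_mult_def vec_lambda_beta
    by (intro sum.cong) (auto simp: matrix_unit_def)
  then show ?thesis by simp
qed

lemma witness_id:
  "witness (id :: complex ^ 'a ^ 'a \<Rightarrow> _) = real CARD('a) * (2 * real CARD('a) - 1)"
  by (simp add: witness_def matrix_unit_def mat_def algebra_simps)

lemma witness_sum: "witness (\<lambda>X. \<Sum>k\<in>K. a k *\<^sub>R F k X) = (\<Sum>k\<in>K. a k * witness (F k))"
proof -
  have "(\<Sum>i\<in>UNIV. \<Sum>j\<in>UNIV. \<Sum>k\<in>K. a k * Re (F k (matrix_unit i j) $ i $ j))
     = (\<Sum>k\<in>K. a k * (\<Sum>i\<in>UNIV. \<Sum>j\<in>UNIV. Re (F k (matrix_unit i j) $ i $ j)))"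
    by (simp add: sum.swap[of _ K] sum_distrib_left)
  moreover have "(\<Sum>i\<in>UNIV. \<Sum>k\<in>K. a k * Re (F k (mat 1) $ i $ i))
     = (\<Sum>k\<in>K. a k * (\<Sum>i\<in>UNIV. Re (F k (mat 1) $ i $ i)))"
    by (simp add: sum.swap[of _ K] sum_distrib_left)
  ultimately show ?thesis
    by (simp add: witness_def right_diff_distrib sum_subtractf sum_distrib_left mult.left_commute)
qed

text \<open>Since tr[M |i><j|] is \<open>M $ j $ i\<close>, the first double sum contracts to the
  trace of \<open>M ** \<sigma>\<close>; unit trace of \<open>\<sigma>\<close> reduces the second
  sum to the trace of \<open>M\<close>.\<close>

lemma witness_measure_prepare:
  fixes \<beta> :: real
  assumes "trace \<sigma> = 1"
  shows "witness (\<lambda>\<rho>. cscale (of_real \<beta> * trace (M ** \<rho>)) \<sigma>)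
     = \<beta> * (2 * Re (trace (M ** \<sigma>)) - Re (trace M))"
proof -
  have "(\<Sum>i\<in>UNIV. \<Sum>j\<in>UNIV. Re (cscale (of_real \<beta> * trace (M ** matrix_unit i j)) \<sigma> $ i $ j))
     = Re (of_real \<beta> * (\<Sum>i\<in>UNIV. \<Sum>j\<in>UNIV. M $ j $ i * \<sigma> $ i $ j))"
    by (simp add: trace_mult_matrix_unit cscale_def sum_distrib_left mult.assoc del: times_complex.sel)
  also have "(\<Sum>i\<in>UNIV. \<Sum>j\<in>UNIV. M $ j $ i * \<sigma> $ i $ j) = trace (M ** \<sigma>)"
    unfolding trace_def matrix_matrix_mult_def vec_lambda_beta by (rule sum.swap)
  finally have 1: "(\<Sum>i\<in>UNIV. \<Sum>j\<in>UNIV. Re (cscale (of_real \<beta> * trace (M ** matrix_unit i j)) \<sigma> $ i $ j))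
     = \<beta> * Re (trace (M ** \<sigma>))"
    by simp
  have "(\<Sum>i\<in>UNIV. Re (cscale (of_real \<beta> * trace (M ** mat 1)) \<sigma> $ i $ i))
     = Re (of_real \<beta> * trace M * trace \<sigma>)"
    by (simp add: cscale_def trace_def sum_distrib_left del: times_complex.sel)
  then have 2: "(\<Sum>i\<in>UNIV. Re (cscale (of_real \<beta> * trace (M ** mat 1)) \<sigma> $ i $ i)) = \<beta> * Re (trace M)"
    by (simp add: assms)
  show ?thesis
    unfolding witness_def 1 2 by (simp add: algebra_simps)
qed

lemma has_sum_finite_sum:
  fixes f :: "'i \<Rightarrow> 'k \<Rightarrow> 'b :: {topological_comm_monoid_add, t2_space}"
  assumes "\<And>k. k \<in> K \<Longrightarrow> ((\<lambda>i. f i k) has_sum s k) I"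
  shows "((\<lambda>i. \<Sum>k\<in>K. f i k) has_sum (\<Sum>k\<in>K. s k)) I"
  using assms by (induction K rule: infinite_finite_induct) (auto intro: has_sum_add)

lemma has_sum_Re_entry:
  fixes f :: "'i \<Rightarrow> complex ^ 'a ^ 'b"
  assumes "(f has_sum s) I"
  shows "((\<lambda>i. Re (f i $ k $ l)) has_sum Re (s $ k $ l)) I"
proof -
  have "bounded_linear (\<lambda>X :: complex ^ 'a ^ 'b. Re (X $ k $ l))"
    by (intro linear_conv_bounded_linear[THEN iffD1] linearI) simp_all
  from has_sum_bounded_linear[OF this assms] show ?thesis
    by (simp add: o_def)
qed

text \<open>The functional is a finite real combination of real parts of entries, so it passes
  through infinite sums. This is what handles countably infinite POVMs.\<close>

lemma witness_has_sum:
  assumes "\<And>\<rho>. ((\<lambda>k. f k \<rho>) has_sum F \<rho>) I"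
  shows "((\<lambda>k. witness (f k)) has_sum witness F) I"
  unfolding witness_def
  by (simp only: diff_conv_add_uminus,
      intro has_sum_add has_sum_uminusI has_sum_cmult_right has_sum_finite_sum has_sum_Re_entry assms)

lemma witness_EBC_star:
  fixes F :: "complex ^ 'a ^ 'a \<Rightarrow> complex ^ 'a ^ 'a"
  assumes "F \<in> EBC_star"
  shows "\<bar>witness F\<bar> \<le> real CARD('a)"
proof -
  obtain I :: "nat set" and \<beta> M \<sigma> where M: "\<And>i. i \<in> I \<Longrightarrow> psd (M i)" "(M has_sum mat 1) I"
    and \<sigma>: "\<And>i. i \<in> I \<Longrightarrow> \<bar>\<beta> i\<bar> \<le> (1::real)" "\<And>i. i \<in> I \<Longrightarrow> density_op (\<sigma> i)"
    and F: "\<And>\<rho>. ((\<lambda>i. cscale (of_real (\<beta> i) * trace (M i ** \<rho>)) (\<sigma> i)) has_sum F \<rho>) I"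
  proof -
    obtain I \<beta> M \<sigma> where "povm I M"
      "\<forall>i\<in>I. \<beta> i \<in> {-1..1::real} \<and> density_op (\<sigma> i)"
      "\<forall>\<rho>. ((\<lambda>i. cscale (of_real (\<beta> i) * trace (M i ** \<rho>)) (\<sigma> i)) has_sum F \<rho>) I"
      using assms unfolding EBC_star_def by blast
    then show thesis
      by (intro that[of I M \<beta> \<sigma>]) (auto simp: povm_def abs_le_iff minus_le_iff)
  qed
  let ?w = "\<lambda>i. witness (\<lambda>\<rho>. cscale (of_real (\<beta> i) * trace (M i ** \<rho>)) (\<sigma> i))"
  have W: "(?w has_sum witness F) I"
    by (rule witness_has_sum[OF F])
  have "((\<lambda>i. \<Sum>k\<in>UNIV. Re (M i $ k $ k)) has_sum (\<Sum>k\<in>UNIV. Re ((mat 1 :: complex ^ 'a ^ 'a) $ k $ k))) I"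
    by (intro has_sum_finite_sum has_sum_Re_entry M(2))
  \<comment> \<open>Taking traces in the POVM normalisation: the bounds on the individual outcomes
    add up to exactly d.\<close>
  then have T: "((\<lambda>i. Re (trace (M i))) has_sum real CARD('a)) I"
    by (simp add: trace_def mat_def)
  \<comment> \<open>As tr[M \<sigma>] lies between 0 and tr M, the number 2 tr[M \<sigma>] - tr M
    lies between -tr M and tr M; a weight of modulus at most 1 keeps it there.\<close>
  have le: "\<bar>?w i\<bar> \<le> Re (trace (M i))" if "i \<in> I" for i
  proof -
    have s: "psd (\<sigma> i)" "trace (\<sigma> i) = 1"
      using \<sigma>(2)[OF that] by (auto simp: density_op_def)
    have "\<bar>2 * Re (trace (M i ** \<sigma> i)) - Re (trace (M i))\<bar> \<le> Re (trace (M i))"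
      using trace_mult_psd[OF M(1)[OF that] s(1)] s(2) by (simp add: abs_le_iff)
    then have "\<bar>\<beta> i\<bar> * \<bar>2 * Re (trace (M i ** \<sigma> i)) - Re (trace (M i))\<bar> \<le> 1 * Re (trace (M i))"
      using \<sigma>(1)[OF that] by (intro mult_mono) auto
    then show ?thesis
      by (simp add: witness_measure_prepare[OF s(2)] abs_mult)
  qed
  have "witness F \<le> real CARD('a)"
    by (rule has_sum_mono[OF W T]) (use le in \<open>auto simp: abs_le_iff\<close>)
  moreover have "- witness F \<le> real CARD('a)"
    by (rule has_sum_mono[OF has_sum_uminusI[OF W] T]) (use le in \<open>auto simp: abs_le_iff\<close>)
  ultimately show ?thesis by simp
qed

section \<open>Finite measure-and-prepare maps, for the upper bound\<close>

lemma finite_in_EBC_star: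
  fixes M :: "'k \<Rightarrow> complex ^ 'a ^ 'a" and \<sigma> :: "'k \<Rightarrow> complex ^ 'b ^ 'b"
  assumes "finite K" "\<And>k. k \<in> K \<Longrightarrow> psd (M k)" "(\<Sum>k\<in>K. M k) = mat 1"
    and "\<And>k. k \<in> K \<Longrightarrow> density_op (\<sigma> k)"
  shows "(\<lambda>\<rho>. \<Sum>k\<in>K. cscale (trace (M k ** \<rho>)) (\<sigma> k)) \<in> EBC_star"
proof -
  \<comment> \<open>Outcomes in \<open>EBC_star\<close> are naturals, so \<open>K\<close> is
    enumerated; this lets phase vectors and basis labels serve as outcomes. All weights are
    1.\<close>
  obtain h where h: "bij_betw h {0..<card K} K"
    using ex_bij_betw_nat_finite[OF assms(1)] by blast
  then have hK: "h i \<in> K" if "i < card K" for i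
    using that by (auto dest: bij_betwE)
  have re: "(\<Sum>i\<in>{0..<card K}. f (h i)) = (\<Sum>k\<in>K. f k)" for f :: "'k \<Rightarrow> 'x :: comm_monoid_add"
    by (rule sum.reindex_bij_betw[OF h])
  have "povm {0..<card K} (M \<circ> h)"
    unfolding povm_def using assms(2,3) hK re[of M] has_sum_finite[of "{0..<card K}" "M \<circ> h"]
    by (auto simp: o_def)
  moreover have "((\<lambda>i. cscale (of_real 1 * trace ((M \<circ> h) i ** \<rho>)) ((\<sigma> \<circ> h) i)) has_sum
      (\<Sum>k\<in>K. cscale (trace (M k ** \<rho>)) (\<sigma> k))) {0..<card K}" for \<rho>
    using has_sum_finite[of "{0..<card K}" "\<lambda>i. cscale (trace (M (h i) ** \<rho>)) (\<sigma> (h i))"]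
    by (simp add: re[of "\<lambda>k. cscale (trace (M k ** \<rho>)) (\<sigma> k)"])
  ultimately show ?thesis
    unfolding EBC_star_def using assms(4) hK
    by (intro CollectI exI[of _ "{0..<card K}"] exI[of _ "\<lambda>_. 1"] exI[of _ "M \<circ> h"]
        exI[of _ "\<sigma> \<circ> h"]) auto
qed

section \<open>Random phase vectors and the map they induce\<close>

definition phases :: "(complex ^ 'a) set" where
  "phases = {w. \<forall>i. w $ i \<in> {1, \<i>, -1, -\<i>}}"

lemma finite_phases: "finite (phases :: (complex ^ 'a) set)"
proof (rule finite_subset)
  show "phases \<subseteq> vec_lambda ` (UNIV \<rightarrow>\<^sub>E {1, \<i>, -1, -\<i>} :: ('a \<Rightarrow> complex) set)"
  proof
    fix w :: "complex ^ 'a" assume "w \<in> phases"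
    then show "w \<in> vec_lambda ` (UNIV \<rightarrow>\<^sub>E {1, \<i>, -1, -\<i>})"
      by (intro image_eqI[of _ _ "vec_nth w"]) (auto simp: phases_def)
  qed
  show "finite (vec_lambda ` (UNIV \<rightarrow>\<^sub>E {1, \<i>, -1, -\<i>} :: ('a \<Rightarrow> complex) set))"
    by (intro finite_imageI finite_PiE) auto
qed

lemma card_phases_pos: "0 < card (phases :: (complex ^ 'a) set)"
proof -
  have "(\<chi> i. 1) \<in> (phases :: (complex ^ 'a) set)" by (simp add: phases_def)
  then show ?thesis using finite_phases card_gt_0_iff by blast
qed

lemma phases_unit: "w \<in> phases \<Longrightarrow> w $ i * cnj (w $ i) = 1"
  unfolding phases_def by (drule CollectD, drule spec[of _ i]) auto

text \<open>Phases average out unless the conjugated indices \<open>a\<close>, \<open>j\<close>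
  match the unconjugated \<open>b\<close>, \<open>i\<close> in pairs. Signs 1 and -1 alone would not
  do: they also keep the terms with \<open>a = j\<close> and \<open>b = i\<close>, which contribute
  a transpose.\<close>

lemma phases_fourth_moment:
  "(\<Sum>w\<in>phases. cnj ((w :: complex ^ 'a) $ a) * w $ b * w $ i * cnj (w $ j)) =
    (if a = b \<and> i = j \<or> a = i \<and> b = j then of_nat (card (phases :: (complex ^ 'a) set)) else 0)"
    (is "?S = _")
proof (cases "a = b \<and> i = j \<or> a = i \<and> b = j")
  case True
  have "cnj (w $ a) * w $ b * w $ i * cnj (w $ j) = 1" if "w \<in> phases" for w :: "complex ^ 'a"
  proof -
    have "cnj (w $ a) * w $ b * w $ i * cnj (w $ j) = (w $ b * cnj (w $ a)) * (w $ i * cnj (w $ j))"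
      and "cnj (w $ a) * w $ b * w $ i * cnj (w $ j) = (w $ i * cnj (w $ a)) * (w $ b * cnj (w $ j))"
      by (simp_all add: mult_ac)
    then show ?thesis using True phases_unit[OF that] by (metis mult_1)
  qed
  then show ?thesis using True by simp
next
  case False
  define u where "u x c = (if c = x then \<i> else 1)" for x c :: 'a
  \<comment> \<open>\<open>g x\<close> rotates coordinate \<open>x\<close> by \<open>\<i>\<close>,
    which permutes \<open>phases\<close>.\<close>
  define g where "g x w = (\<chi> c. u x c * w $ c)" for x and w :: "complex ^ 'a"
  have closed: "z \<in> {1, \<i>, -1, -\<i>} \<Longrightarrow> u x c * z \<in> {1, \<i>, -1, -\<i>}"
    "z \<in> {1, \<i>, -1, -\<i>} \<Longrightarrow> cnj (u x c) * z \<in> {1, \<i>, -1, -\<i>}" for x c z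
    by (auto simp: u_def)
  have unit: "cnj (u x c) * (u x c * z) = z" "u x c * (cnj (u x c) * z) = z" for x c z
    by (simp_all add: u_def)
  have bij: "bij_betw (g x) phases phases" for x
    by (rule bij_betwI[where g = "\<lambda>w. \<chi> c. cnj (u x c) * w $ c"])
      (use closed in \<open>simp_all add: g_def phases_def unit\<close>)
  have inv: "?S = (cnj (u x a) * u x b * u x i * cnj (u x j)) * ?S" for x
  proof -
    have "?S = (\<Sum>w\<in>phases. cnj (g x w $ a) * g x w $ b * g x w $ i * cnj (g x w $ j))"
      by (rule sum.reindex_bij_betw[OF bij, symmetric])
    also have "\<dots> = (cnj (u x a) * u x b * u x i * cnj (u x j)) * ?S"
      unfolding sum_distrib_left by (intro sum.cong) (simp_all add: g_def mult_ac)
    finally show ?thesis .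
  qed
  \<comment> \<open>If \<open>a\<close> differs from both \<open>b\<close> and \<open>i\<close>,
    rotating at \<open>a\<close> leaves \<open>-\<i>\<close> or -1. Otherwise \<open>a\<close>
    cancels against one of them and \<open>j\<close> differs from the other, so rotating at
    \<open>j\<close> leaves \<open>-\<i>\<close>.\<close>
  have "\<exists>x. cnj (u x a) * u x b * u x i * cnj (u x j) \<noteq> 1"
  proof (cases "a \<noteq> b \<and> a \<noteq> i")
    case True
    then have "cnj (u a a) * u a b * u a i * cnj (u a j) \<noteq> 1"
      by (auto simp: u_def complex_eq_iff)
    then show ?thesis ..
  next
    case 2: False
    then have "cnj (u j a) * u j b * u j i * cnj (u j j) \<noteq> 1"
      using False by (auto simp: u_def complex_eq_iff)
    then show ?thesis ..
  qed
  \<comment> \<open>Rotating the phase at \<open>x\<close> multiplies the sum by a number other than 1.\<close>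
  then obtain x where "cnj (u x a) * u x b * u x i * cnj (u x j) \<noteq> 1" ..
  then have "?S = 0"
    using inv[of x] unfolding mult_cancel_right1 by blast
  then show ?thesis using False by auto
qed

text \<open>The uniform average of \<open>outer w\<close> over \<open>phases\<close> is the
  identity, while each \<open>outer w\<close> has trace d; hence the two different normalisations
  here and in \<open>phase_state\<close>.\<close>

definition phase_povm :: "complex ^ 'a \<Rightarrow> complex ^ 'a ^ 'a" where
  "phase_povm w = (1 / real (card (phases :: (complex ^ 'a) set))) *\<^sub>R outer w"

definition phase_state :: "complex ^ 'a \<Rightarrow> complex ^ 'a ^ 'a" where
  "phase_state w = (1 / real CARD('a)) *\<^sub>R outer w"

definition phase_channel :: "complex ^ 'a ^ 'a \<Rightarrow> complex ^ 'a ^ 'a" where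
  "phase_channel \<rho> = (\<Sum>w\<in>phases. cscale (trace (phase_povm w ** \<rho>)) (phase_state w))"

lemma trace_scaleR: "trace (r *\<^sub>R X) = of_real r * trace (X :: complex ^ 'a ^ 'a)"
  unfolding trace_def sum_distrib_left
  by (intro sum.cong) (simp_all add: scaleR_conv_of_real[where 'a = complex])

lemma scaleR_matrix_mul: "(r *\<^sub>R X) ** Y = r *\<^sub>R (X ** Y :: complex ^ 'a ^ 'b)"
  by (simp add: vec_eq_iff matrix_matrix_mult_def scaleR_sum_right)

lemma phase_channel_in_EBC_star: "phase_channel \<in> EBC_star"
proof -
  have "(\<Sum>w\<in>phases. phase_povm w) $ i $ j = (mat 1 :: complex ^ 'a ^ 'a) $ i $ j" for i j
  proof -
    \<comment> \<open>Inserting a factor of modulus one reduces the second moment to the fourth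
      moment with \<open>a = b = i\<close>.\<close>
    have "(\<Sum>w\<in>phases. (w :: complex ^ 'a) $ i * cnj (w $ j)) = (\<Sum>w\<in>phases. cnj (w $ i) * w $ i * w $ i * cnj (w $ j))"
    proof (rule sum.cong)
      fix w :: "complex ^ 'a" assume "w \<in> phases"
      then have "cnj (w $ i) * w $ i = 1" using phases_unit by (metis mult.commute)
      then show "w $ i * cnj (w $ j) = cnj (w $ i) * w $ i * w $ i * cnj (w $ j)" by simp
    qed simp
    then show ?thesis
      using card_phases_pos[where 'a = 'a]
      by (simp add: phase_povm_def outer_def phases_fourth_moment mat_def scaleR_sum_right[symmetric]
          scaleR_conv_of_real[where 'a = complex])
  qed
  then have "(\<Sum>w\<in>phases. phase_povm w) = (mat 1 :: complex ^ 'a ^ 'a)"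
    by (simp add: vec_eq_iff)
  moreover have "density_op (phase_state w)" if "w \<in> phases" for w :: "complex ^ 'a"
    using phases_unit[OF that]
    by (simp add: density_op_def phase_state_def psd_scaleR psd_outer trace_scaleR) (simp add: trace_def outer_def)
  ultimately show ?thesis
    unfolding phase_channel_def[abs_def]
    by (intro finite_in_EBC_star finite_phases) (auto simp: phase_povm_def psd_scaleR psd_outer)
qed

text \<open>The pairing \<open>a = b\<close>, \<open>i = j\<close> puts the trace on the diagonal;
  the pairing \<open>a = i\<close>, \<open>b = j\<close> reproduces the off-diagonal
  entries.\<close>

lemma phase_channel_apply:
  fixes \<rho> :: "complex ^ 'a ^ 'a"
  shows "real CARD('a) *\<^sub>R phase_channel \<rho> = (\<chi> i j. if i = j then trace \<rho> else \<rho> $ i $ j)"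
proof -
  let ?P = "phases :: (complex ^ 'a) set"
  have "(real CARD('a) *\<^sub>R phase_channel \<rho>) $ i $ j = (if i = j then trace \<rho> else \<rho> $ i $ j)" for i j
  proof -
    have t: "trace (outer w ** \<rho>) = (\<Sum>a\<in>UNIV. \<Sum>b\<in>UNIV. cnj (w $ a) * w $ b * \<rho> $ a $ b)" for w
      unfolding trace_def matrix_matrix_mult_def vec_lambda_beta
      by (subst sum.swap) (simp add: outer_def algebra_simps)
    have "cscale (trace (phase_povm w ** \<rho>)) (phase_state w) $ i $ j
      = trace (outer w ** \<rho>) * (w $ i * cnj (w $ j)) / of_nat (card ?P) / of_nat CARD('a)" for w
      by (simp add: phase_povm_def phase_state_def cscale_def outer_def[of w] trace_scaleR
          scaleR_matrix_mul scaleR_conv_of_real[where 'a = complex])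
    then have "(real CARD('a) *\<^sub>R phase_channel \<rho>) $ i $ j
       = (\<Sum>w\<in>?P. trace (outer w ** \<rho>) * (w $ i * cnj (w $ j))) / of_nat (card ?P)"
      by (simp add: phase_channel_def scaleR_conv_of_real[where 'a = complex] flip: sum_divide_distrib)
    also have "(\<Sum>w\<in>?P. trace (outer w ** \<rho>) * (w $ i * cnj (w $ j)))
       = (\<Sum>w\<in>?P. \<Sum>a\<in>UNIV. \<Sum>b\<in>UNIV. \<rho> $ a $ b * (cnj (w $ a) * w $ b * w $ i * cnj (w $ j)))"
      unfolding t sum_distrib_right by (intro sum.cong) (simp_all add: mult_ac)
    also have "\<dots> = (\<Sum>a\<in>UNIV. \<Sum>b\<in>UNIV. \<rho> $ a $ b * (\<Sum>w\<in>?P. cnj (w $ a) * w $ b * w $ i * cnj (w $ j)))"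
      by (simp add: sum.swap[of _ ?P] sum_distrib_left)
    also have "\<dots> = of_nat (card ?P) * (\<Sum>a\<in>UNIV. \<Sum>b\<in>UNIV. if a = b \<and> i = j \<or> a = i \<and> b = j then \<rho> $ a $ b else 0)"
      unfolding phases_fourth_moment sum_distrib_left by (intro sum.cong) auto
    \<comment> \<open>For \<open>i = j\<close> the second pairing is a special case of the first, so
      the diagonal is the trace with no extra \<open>\<rho> $ i $ i\<close>.\<close>
    also have "(\<Sum>a\<in>UNIV. \<Sum>b\<in>UNIV. if a = b \<and> i = j \<or> a = i \<and> b = j then \<rho> $ a $ b else 0)
       = (if i = j then trace \<rho> else \<rho> $ i $ j)"
    proof (cases "i = j")
      case True
      then have "(\<Sum>a\<in>UNIV. \<Sum>b\<in>UNIV. if a = b \<and> i = j \<or> a = i \<and> b = j then \<rho> $ a $ b else 0)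
        = (\<Sum>a\<in>UNIV. \<Sum>b\<in>UNIV. if b = a then \<rho> $ a $ b else 0)"
        by (intro sum.cong) auto
      then show ?thesis using True by (simp add: trace_def)
    next
      case False
      then have "(\<Sum>a\<in>UNIV. \<Sum>b\<in>UNIV. if a = b \<and> i = j \<or> a = i \<and> b = j then \<rho> $ a $ b else 0)
        = (\<Sum>a\<in>UNIV. \<Sum>b\<in>UNIV. if b = j then if a = i then \<rho> $ a $ b else 0 else 0)"
        by (intro sum.cong) auto
      then show ?thesis using False by simp
    qed
    finally show ?thesis
      using card_phases_pos[where 'a = 'a] by simp
  qed
  then show ?thesis by (simp add: vec_eq_iff)
qed

section \<open>The map that corrects the diagonal\<close>

definition complement_channel :: "complex ^ 'a ^ 'a \<Rightarrow> complex ^ 'a ^ 'a" where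
  "complement_channel \<rho> = (\<Sum>k\<in>UNIV. cscale (trace (outer (axis k 1) ** \<rho>))
     ((1 / (real CARD('a) - 1)) *\<^sub>R (mat 1 - outer (axis k 1))))"

lemma outer_axis: "outer (axis k 1) $ i $ j = (if i = k \<and> j = k then 1 else 0)"
  by (auto simp: outer_def axis_def)

text \<open>The form is |v|^2 - |v_k|^2, and no coordinate exceeds the norm.\<close>

lemma psd_mat_1_minus_outer_axis: "psd (mat 1 - outer (axis k 1) :: complex ^ 'a ^ 'a)"
proof -
  have "qform (mat 1) v = of_real ((norm v)\<^sup>2)" for v :: "complex ^ 'a"
    using trace_outer[of v] by (simp add: qform_def trace_def outer_def mult.commute)
  then show ?thesis
    by (simp add: psd_iff_qform qform_diff qform_outer sum_cnj_axis power_mono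
        Finite_Cartesian_Product.norm_nth_le del: of_real_power)
qed

lemma complement_channel_in_EBC_star:
  assumes "CARD('a) > 1"
  shows "(complement_channel :: complex ^ 'a ^ 'a \<Rightarrow> _) \<in> EBC_star"
proof -
  have sum1: "(\<Sum>k\<in>UNIV. outer (axis k 1)) = (mat 1 :: complex ^ 'a ^ 'a)"
  proof -
    have "(\<Sum>k\<in>UNIV. outer (axis k 1)) $ i $ j = (mat 1 :: complex ^ 'a ^ 'a) $ i $ j" for i j
    proof -
      have "(\<Sum>k\<in>UNIV. outer (axis k 1)) $ i $ j
        = (\<Sum>k\<in>UNIV. if k = i then if i = j then 1 else 0 else 0 :: complex)"
        unfolding sum_component outer_axis by (intro sum.cong) auto
      then show ?thesis by (simp add: mat_def)
    qed
    then show ?thesis by (simp add: vec_eq_iff)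
  qed
  have "trace (mat 1 - outer (axis k 1) :: complex ^ 'a ^ 'a) = of_real (real CARD('a) - 1)" for k
    by (simp add: trace_sub trace_I trace_outer)
  then have "density_op ((1 / (real CARD('a) - 1)) *\<^sub>R (mat 1 - outer (axis k 1)) :: complex ^ 'a ^ 'a)" for k
    using assms
    by (simp add: density_op_def psd_scaleR psd_mat_1_minus_outer_axis trace_scaleR del: of_real_diff)
  then show ?thesis
    unfolding complement_channel_def[abs_def]
    by (intro finite_in_EBC_star) (auto simp: psd_outer sum1)
qed

text \<open>Outcome \<open>k\<close> has weight \<open>\<rho> $ k $ k\<close> and contributes to
  every diagonal entry except the one at \<open>k\<close>, so entry \<open>i\<close> collects the
  trace without \<open>\<rho> $ i $ i\<close>.\<close>

lemma complement_channel_apply: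
  fixes \<rho> :: "complex ^ 'a ^ 'a"
  assumes "CARD('a) > 1"
  shows "(real CARD('a) - 1) *\<^sub>R complement_channel \<rho> = (\<chi> i j. if i = j then trace \<rho> - \<rho> $ i $ i else 0)"
proof -
  have "((real CARD('a) - 1) *\<^sub>R complement_channel \<rho>) $ i $ j
    = (if i = j then trace \<rho> - \<rho> $ i $ i else 0)" for i j
  proof -
    have "outer (axis k 1) = matrix_unit k k" for k :: 'a
      by (simp add: vec_eq_iff outer_axis matrix_unit_def)
    then have t: "trace (outer (axis k 1) ** \<rho>) = \<rho> $ k $ k" for k
      by (metis trace_mul_sym trace_mult_matrix_unit)
    have "((real CARD('a) - 1) *\<^sub>R complement_channel \<rho>) $ i $ j
      = (\<Sum>k\<in>UNIV. \<rho> $ k $ k * (mat 1 - outer (axis k 1)) $ i $ j)"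
      using assms by (simp add: complement_channel_def t cscale_def scaleR_sum_right)
    also have "\<dots> = (\<Sum>k\<in>UNIV. if i = j then \<rho> $ k $ k - (if k = i then \<rho> $ k $ k else 0) else 0)"
      by (intro sum.cong) (auto simp: mat_def outer_axis)
    finally show ?thesis
      by (simp add: sum_subtractf trace_def)
  qed
  then show ?thesis by (simp add: vec_eq_iff)
qed

section \<open>Combining the two bounds\<close>

theorem theorem5p77:
  "quasiprob_extent EBC_star (id :: complex ^ 'd ^ 'd \<Rightarrow> complex ^ 'd ^ 'd)
     = ereal (2 * real CARD('d) - 1)"
proof (rule antisym)
  let ?d = "real CARD('d)"
  have d: "?d > 0" by simp
  show "quasiprob_extent EBC_star (id :: complex ^ 'd ^ 'd \<Rightarrow> _) \<le> ereal (2 * ?d - 1)"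
  proof (cases "CARD('d) = 1") \<comment> \<open>no state is orthogonal to \<open>|k\<rangle>\<close> in dimension 1\<close>
    case True
    \<comment> \<open>The only entry is the trace, so \<open>phase_channel\<close> is already the
      identity, with cost 1 = 2d - 1.\<close>
    have "id = (\<lambda>X :: complex ^ 'd ^ 'd. \<Sum>i<1::nat. 1 *\<^sub>R phase_channel X)"
    proof
      fix X :: "complex ^ 'd ^ 'd"
      obtain x :: 'd where x: "UNIV = {x}"
        using True by (rule card_1_singletonE)
      then have "i = x" for i by (metis UNIV_I singletonD)
      then have "X $ i $ j = X $ x $ x" for i j by metis
      then have "X = (\<chi> i j. if i = j then trace X else X $ i $ j)"
        by (simp add: vec_eq_iff trace_def x)
      then show "id X = (\<Sum>i<1::nat. 1 *\<^sub>R phase_channel X)"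
        using phase_channel_apply[of X] True by simp
    qed
    then show ?thesis
      unfolding quasiprob_extent_def using phase_channel_in_EBC_star[where 'a = 'd] True
      by (intro Inf_lower CollectI exI[of _ "1::nat"] exI[of _ "\<lambda>_. 1"] exI[of _ "\<lambda>_. phase_channel"])
        (auto simp: one_ereal_def)
  next
    case False
    then have d1: "CARD('d) > 1" using d by linarith
    let ?a = "\<lambda>i. if i = 0 then ?d else - (?d - 1)"
    let ?F = "\<lambda>i::nat. if i = 0 then phase_channel else complement_channel :: complex ^ 'd ^ 'd \<Rightarrow> _"
    have "id = (\<lambda>X :: complex ^ 'd ^ 'd. \<Sum>i<2::nat. ?a i *\<^sub>R ?F i X)"
    proof
      fix X :: "complex ^ 'd ^ 'd"
      have "(\<Sum>i<2::nat. ?a i *\<^sub>R ?F i X)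
        = ?d *\<^sub>R phase_channel X - (?d - 1) *\<^sub>R complement_channel X"
        by (simp add: numeral_2_eq_2 flip: scaleR_minus_left)
      also have "\<dots> = X"
        unfolding phase_channel_apply complement_channel_apply[OF d1] by (simp add: vec_eq_iff)
      finally show "id X = (\<Sum>i<2::nat. ?a i *\<^sub>R ?F i X)" by simp
    qed
    moreover have "(\<Sum>i<2::nat. \<bar>?a i\<bar>) = 2 * ?d - 1"
      using d1 by (simp add: numeral_2_eq_2)
    ultimately show ?thesis
      unfolding quasiprob_extent_def
      using phase_channel_in_EBC_star[where 'a = 'd] complement_channel_in_EBC_star[OF d1]
      by (intro Inf_lower CollectI exI[of _ "2::nat"] exI[of _ ?a] exI[of _ ?F]) auto
  qed
  show "ereal (2 * ?d - 1) \<le> quasiprob_extent EBC_star (id :: complex ^ 'd ^ 'd \<Rightarrow> _)"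
    unfolding quasiprob_extent_def
  proof (rule Inf_greatest, clarify)
    fix m a and F :: "nat \<Rightarrow> complex ^ 'd ^ 'd \<Rightarrow> complex ^ 'd ^ 'd"
    assume F: "\<forall>i<m. F i \<in> EBC_star" and eq: "id = (\<lambda>X. \<Sum>i<m. a i *\<^sub>R F i X)"
    \<comment> \<open>Evaluating the witness on both sides of the decomposition; its bound d on
      \<open>EBC_star\<close> then cancels the factor d on the left.\<close>
    have "?d * (2 * ?d - 1) = (\<Sum>i<m. a i * witness (F i))"
      using arg_cong[OF eq, of witness] unfolding witness_id witness_sum .
    also have "\<dots> \<le> (\<Sum>i<m. \<bar>a i\<bar> * ?d)"
    proof (intro sum_mono)
      fix i assume "i \<in> {..<m}"
      then have "\<bar>a i\<bar> * \<bar>witness (F i)\<bar> \<le> \<bar>a i\<bar> * ?d"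
        using witness_EBC_star F by (intro mult_left_mono) auto
      then show "a i * witness (F i) \<le> \<bar>a i\<bar> * ?d"
        using abs_ge_self[of "a i * witness (F i)"] by (simp add: abs_mult)
    qed
    also have "\<dots> = ?d * (\<Sum>i<m. \<bar>a i\<bar>)"
      by (simp add: sum_distrib_left mult.commute)
    finally show "ereal (2 * ?d - 1) \<le> ereal (\<Sum>i<m. \<bar>a i\<bar>)"
      using d by simp
  qed
qed

end
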